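(* Let $(K_1,\ldots,K_n)$ be a Cantor-type graph-directed attractor in $\mathbb{R}^d$. For every pair of distinct $i,j\in\{1,\ldots,n\}$, $K_i\cap K_j\neq\varnothing$ if and only if there exists, in the associated intersection graph, either a terminated finite walk starting from $(i,j)$ or an infinite solid walk starting from $(i,j)$.
   Context: Setting. Let $d\ge 1$, $n\ge 1$ and $N\geq 2$ be integers. Let $G$ be a finite directed graph (loops and multiple edges allowed) with vertex set $\{1,\ldots,n\}$ and edge set $\mathcal{E}$, such that every vertex has at least one outgoing edge; $\mathcal{E}_{i,j}$ denotes the set of edges from $i$ to $j$. To each $e\in\mathcal{E}$ is assigned a map $\varphi_e:\mathbb{R}^d\to\mathbb{R}^d$, $\varphi_e(x)=N^{-1}(x+t_e)$ with $t_e\in\{0,1,\ldots,N-1\}^d$ (the same $N$ for all edges). It is assumed that $\varphi_e\neq\varphi_{e'}$ for distinct $e,e'$ in the same $\mathcal{E}_{i,j}$. The associated Cantor-type graph-directed attractor is the unique $n$-tuple $(K_1,\ldots,K_n)$ of non-empty compact sets in $\mathbb{R}^d$ with $K_i=\bigcup_{j=1}^n\bigcup_{e\in\mathcal{E}_{i,j}}\varphi_e(K_j)$ for all $i$. Intersection graph. This is a directed graph with vertex set $\{(i,j):1\le i,j\le n\}$ and two types of edges, solid and dashed. Edges start only from vertices $(i,j)$ with $i\neq j$. For such $(i,j)$ and any vertex $(i',j')$: (1) there is a solid edge from $(i,j)$ to $(i',j')$ if there are $e\in\mathcal{E}_{i,i'}$ and $e'\in\mathcal{E}_{j,j'}$ with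 $\varphi_e=\varphi_{e'}$; (2) there is a dashed edge from $(i,j)$ to $(i',j')$ if there are $e\in\mathcal{E}_{i,i'}$ and $e'\in\mathcal{E}_{j,j'}$ such that $\varphi_e([0,1]^d)\cap\varphi_{e'}([0,1]^d)$ is a common $s$-dimensional face of these two cubes for some $0\le s\le d-1$. (There is at most one edge of each type from one vertex to another.) Walks may repeat vertices and edges. A walk is solid if all its edges are solid. An edge from $(i,j)$ to $(i',j')$ is terminated if either it is solid and $i'=j'$, or it is dashed and there are $e\in\mathcal{E}_{i,i'}$, $e'\in\mathcal{E}_{j,j'}$ such that $\varphi_e([0,1]^d)\cap\varphi_{e'}([0,1]^d)$ is a common face of dimension at most $d-1$ of these two cubes and $\varphi_e(K_{i'})\cap\varphi_{e'}(K_{j'})\neq\varnothing$. A terminated finite walk is either a single terminated edge (length $1$) or a walk of length $m\ge 2$ whose first $m-1$ edges are solid and whose last edge is terminated. *)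

theory Defs
  imports "HOL-Analysis.Analysis" "Graph_Theory.Arc_Walk"
begin

definition arcs_between :: "('v, 'e) pre_digraph \<Rightarrow> 'v \<Rightarrow> 'v \<Rightarrow> 'e set" where
  "arcs_between G i j = {e \<in> arcs G. tail G e = i \<and> head G e = j}"

definition cantor_map :: "nat \<Rightarrow> real ^ 'd \<Rightarrow> real ^ 'd \<Rightarrow> real ^ 'd" where
  "cantor_map N t x = inverse (real N) *\<^sub>R (x + t)"

text \<open>
  The tuple is indexed by the vertices of the graph; values of \<open>K\<close> outside \<open>verts G\<close> are
  irrelevant. By the graph-directed version of Hutchinson's theorem, for contractions and a finite
  graph in which every vertex has an outgoing edge there is exactly one such tuple on
  \<open>verts G\<close>, so this predicate identifies it.
\<close>

definition gd_attractor ::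
  "('v, 'e) pre_digraph \<Rightarrow> ('e \<Rightarrow> real ^ 'd \<Rightarrow> real ^ 'd) \<Rightarrow> ('v \<Rightarrow> (real ^ 'd) set) \<Rightarrow> bool" where
  "gd_attractor G \<phi> K \<longleftrightarrow>
     (\<forall>i \<in> verts G. K i \<noteq> {} \<and> compact (K i) \<and>
        K i = (\<Union>j \<in> verts G. \<Union>e \<in> arcs_between G i j. \<phi> e ` K j))"

definition unit_cube :: "(real ^ 'd) set" where
  "unit_cube = cbox 0 1"

text \<open>
  The empty set satisfies \<^const>\<open>face_of\<close> and has \<^const>\<open>aff_dim\<close> equal to \<open>-1\<close>; the bound
  \<open>0 \<le> s\<close> excludes it.
\<close>

definition common_proper_face :: "(real ^ 'd) set \<Rightarrow> (real ^ 'd) set \<Rightarrow> bool" where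
  "common_proper_face A B \<longleftrightarrow>
     (\<exists>s. 0 \<le> s \<and> s \<le> int CARD('d) - 1 \<and>
        (A \<inter> B) face_of A \<and> (A \<inter> B) face_of B \<and> aff_dim (A \<inter> B) = s)"

datatype edge_kind = Solid | Dashed

text \<open>
  An edge of the intersection graph is determined by its kind, its source and its target.
\<close>

type_synonym 'v int_edge = "edge_kind \<times> ('v \<times> 'v) \<times> ('v \<times> 'v)"

fun int_edge_rel ::
  "('v, 'e) pre_digraph \<Rightarrow> ('e \<Rightarrow> real ^ 'd \<Rightarrow> real ^ 'd) \<Rightarrow> 'v int_edge \<Rightarrow> bool" where
  "int_edge_rel G \<phi> (Solid, (i, j), (i', j')) \<longleftrightarrow>
     (\<exists>e \<in> arcs_between G i i'. \<exists>e' \<in> arcs_between G j j'. \<phi> e = \<phi> e')"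
| "int_edge_rel G \<phi> (Dashed, (i, j), (i', j')) \<longleftrightarrow>
     (\<exists>e \<in> arcs_between G i i'. \<exists>e' \<in> arcs_between G j j'.
        common_proper_face (\<phi> e ` unit_cube) (\<phi> e' ` unit_cube))"

definition intersection_graph ::
  "('v, 'e) pre_digraph \<Rightarrow> ('e \<Rightarrow> real ^ 'd \<Rightarrow> real ^ 'd) \<Rightarrow> ('v \<times> 'v, 'v int_edge) pre_digraph" where
  "intersection_graph G \<phi> =
     \<lparr>verts = verts G \<times> verts G,
      arcs = {(c, (i, j), (i', j')) | c i j i' j'.
        i \<in> verts G \<and> j \<in> verts G \<and> i' \<in> verts G \<and> j' \<in> verts G \<and> i \<noteq> j \<and>
        int_edge_rel G \<phi> (c, (i, j), (i', j'))},
      tail = (\<lambda>(c, u, v). u),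
      head = (\<lambda>(c, u, v). v)\<rparr>"

definition solid :: "'v int_edge \<Rightarrow> bool" where
  "solid a \<longleftrightarrow> fst a = Solid"

fun terminated ::
  "('v, 'e) pre_digraph \<Rightarrow> ('e \<Rightarrow> real ^ 'd \<Rightarrow> real ^ 'd) \<Rightarrow> ('v \<Rightarrow> (real ^ 'd) set) \<Rightarrow>
     'v int_edge \<Rightarrow> bool" where
  "terminated G \<phi> K (Solid, (i, j), (i', j')) \<longleftrightarrow> i' = j'"
| "terminated G \<phi> K (Dashed, (i, j), (i', j')) \<longleftrightarrow>
     (\<exists>e \<in> arcs_between G i i'. \<exists>e' \<in> arcs_between G j j'.
        common_proper_face (\<phi> e ` unit_cube) (\<phi> e' ` unit_cube) \<and>
        \<phi> e ` K i' \<inter> \<phi> e' ` K j' \<noteq> {})"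

definition terminated_finite_walk ::
  "('v, 'e) pre_digraph \<Rightarrow> ('e \<Rightarrow> real ^ 'd \<Rightarrow> real ^ 'd) \<Rightarrow> ('v \<Rightarrow> (real ^ 'd) set) \<Rightarrow>
     'v \<times> 'v \<Rightarrow> 'v int_edge list \<Rightarrow> bool" where
  "terminated_finite_walk G \<phi> K u p \<longleftrightarrow>
     (\<exists>v. pre_digraph.awalk (intersection_graph G \<phi>) u p v) \<and> p \<noteq> [] \<and>
     (\<forall>a \<in> set (butlast p). solid a) \<and> terminated G \<phi> K (last p)"

definition infinite_walk :: "('v, 'e) pre_digraph \<Rightarrow> 'v \<Rightarrow> (nat \<Rightarrow> 'e) \<Rightarrow> bool" where
  "infinite_walk H u w \<longleftrightarrow>
     tail H (w 0) = u \<and> (\<forall>k. w k \<in> arcs H \<and> head H (w k) = tail H (w (Suc k)))"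

definition infinite_solid_walk ::
  "('v, 'e) pre_digraph \<Rightarrow> ('e \<Rightarrow> real ^ 'd \<Rightarrow> real ^ 'd) \<Rightarrow> 'v \<times> 'v \<Rightarrow>
     (nat \<Rightarrow> 'v int_edge) \<Rightarrow> bool" where
  "infinite_solid_walk G \<phi> u w \<longleftrightarrow>
     infinite_walk (intersection_graph G \<phi>) u w \<and> (\<forall>k. solid (w k))"

end

(* The cubes phi_e([0,1]^d) lie on the grid of mesh 1/N, so two of them coincide, meet in a common
   proper face, or are disjoint. Hence a common point of K_i and K_j yields either a solid edge to
   a pair whose attractors meet again (or coincide), or a terminated dashed edge; iterating gives a
   terminated walk or an infinite solid walk. Conversely, a common point is pulled back along solid
   edges, and each solid edge contracts the distance between the two attractors by the factor 1/N,
   so along an infinite solid walk this distance has to be 0. *)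
theory Submission
  imports Defs
begin

section \<open>Digit maps and the grid cubes of side 1/N\<close>

lemma cantor_map_nth [simp]: "cantor_map N t x $ k = (x $ k + t $ k) / real N"
  by (simp add: cantor_map_def divide_inverse mult.commute)

lemma inj_cantor_map:
  assumes "N > 0" shows "inj (cantor_map N t)"
  using assms by (auto simp: inj_def cantor_map_def)

lemma dist_cantor_map: "dist (cantor_map N t x) (cantor_map N t y) = dist x y / real N"
proof -
  have "cantor_map N t x - cantor_map N t y = inverse (real N) *\<^sub>R (x - y)"
    by (simp add: cantor_map_def scaleR_diff_right scaleR_add_right)
  then show ?thesis
    by (simp add: dist_norm divide_inverse mult.commute)
qed

lemma cantor_map_image_unit_cube:
  fixes t :: "real ^ 'd"
  assumes "N > 0"
  shows "cantor_map N t ` unit_cube = cbox (cantor_map N t 0) (cantor_map N t 1)"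
proof (intro subset_antisym subsetI)
  fix x assume "x \<in> cantor_map N t ` unit_cube"
  then show "x \<in> cbox (cantor_map N t 0) (cantor_map N t 1)"
    by (auto simp: unit_cube_def mem_box_cart divide_right_mono)
next
  fix x assume x: "x \<in> cbox (cantor_map N t 0) (cantor_map N t 1)"
  have "real N *\<^sub>R x - t \<in> unit_cube"
    using x assms by (auto simp: unit_cube_def mem_box_cart field_simps)
  moreover have "x = cantor_map N t (real N *\<^sub>R x - t)"
    using assms by (simp add: cantor_map_def)
  ultimately show "x \<in> cantor_map N t ` unit_cube" by blast
qed

text \<open>After scaling by \<open>N\<close>, each coordinate compares two unit intervals with
  integer ends. If they meet, they coincide or share one endpoint. An endpoint is extreme in its
  interval, so a segment of the first interval with that endpoint in its interior is
  constant.\<close>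

lemma grid_cubes_Int_face_of:
  fixes t t' :: "real ^ 'd"
  assumes N: "N > 0" and int: "\<And>k. t $ k \<in> \<int>" "\<And>k. t' $ k \<in> \<int>"
  shows "cantor_map N t ` unit_cube \<inter> cantor_map N t' ` unit_cube
    face_of cantor_map N t ` unit_cube"
proof -
  let ?A = "cbox (cantor_map N t 0) (cantor_map N t 1)"
  let ?B = "cbox (cantor_map N t' 0) (cantor_map N t' 1)"
  have mem: "z \<in> cbox (cantor_map N s 0) (cantor_map N s 1) \<longleftrightarrow>
      (\<forall>k. s $ k \<le> real N * z $ k \<and> real N * z $ k \<le> s $ k + 1)" for z s :: "real ^ 'd"
    using N by (auto simp: mem_box_cart field_simps)
  \<comment> \<open>In the definition of \<open>face_of\<close> the endpoints already lie in the
    first cube, so only membership in the second one remains.\<close>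
  have ends: "a \<in> ?B \<and> b \<in> ?B"
    if a: "a \<in> ?A" and b: "b \<in> ?A" and xA: "x \<in> ?A" and xB: "x \<in> ?B"
      and x: "x \<in> open_segment a b" for a b x
  proof -
    obtain u where u: "0 < u" "u < 1" "x = (1 - u) *\<^sub>R a + u *\<^sub>R b"
      using x by (auto simp: in_segment)
    have "(t' $ k \<le> real N * a $ k \<and> real N * a $ k \<le> t' $ k + 1) \<and>
          (t' $ k \<le> real N * b $ k \<and> real N * b $ k \<le> t' $ k + 1)" for k
    proof -
      obtain p q where p: "t $ k = of_int p" and q: "t' $ k = of_int q"
        using int[of k] by (auto elim!: Ints_cases)
      define \<alpha> \<beta> where "\<alpha> = real N * a $ k" and "\<beta> = real N * b $ k"
      have xk: "real N * x $ k = (1 - u) * \<alpha> + u * \<beta>"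
        by (simp add: u \<alpha>_def \<beta>_def algebra_simps)
      have bounds: "p \<le> \<alpha>" "\<alpha> \<le> p + 1" "p \<le> \<beta>" "\<beta> \<le> p + 1"
        using a[unfolded mem, rule_format, of k] b[unfolded mem, rule_format, of k]
        by (simp_all add: \<alpha>_def \<beta>_def p)
      have xk': "p \<le> real N * x $ k" "real N * x $ k \<le> p + 1"
          "q \<le> real N * x $ k" "real N * x $ k \<le> q + 1"
        using xA[unfolded mem, rule_format, of k] xB[unfolded mem, rule_format, of k]
        by (simp_all add: p q)
      \<comment> \<open>The coordinate of \<open>x\<close> lies in both [p, p+1] and [q, q+1], and
        \<open>p\<close>, \<open>q\<close> are integers, so only three relative positions are
        left.\<close>
      then have "p \<le> q + 1" "q \<le> p + 1"
        by linarith+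
      then consider "p = q" | "q = p + 1" | "p = q + 1"
        by linarith
      then show ?thesis
      proof cases
        case 1
        then show ?thesis using bounds by (simp add: q \<alpha>_def \<beta>_def)
      next
        case 2
        \<comment> \<open>Here the coordinate of \<open>x\<close> is forced to be the common
          endpoint p + 1. It is a weighted mean of \<open>\<alpha>\<close> and
          \<open>\<beta>\<close>, neither of which exceeds p + 1, so both gaps vanish. Case 3 is the
          mirror image at the lower end.\<close>
        then have "(1 - u) * (p + 1 - \<alpha>) + u * (p + 1 - \<beta>) = 0"
          using xk xk' by (simp add: algebra_simps)
        moreover have "(1 - u) * (p + 1 - \<alpha>) \<ge> 0" "u * (p + 1 - \<beta>) \<ge> 0"
          using u bounds by auto
        ultimately have "(1 - u) * (p + 1 - \<alpha>) = 0" "u * (p + 1 - \<beta>) = 0"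
          by linarith+
        then show ?thesis using 2 u by (simp add: q flip: \<alpha>_def \<beta>_def)
      next
        case 3
        then have "(1 - u) * (\<alpha> - p) + u * (\<beta> - p) = 0"
          using xk xk' by (simp add: algebra_simps)
        moreover have "(1 - u) * (\<alpha> - p) \<ge> 0" "u * (\<beta> - p) \<ge> 0"
          using u bounds by auto
        ultimately have "(1 - u) * (\<alpha> - p) = 0" "u * (\<beta> - p) = 0"
          by linarith+
        then show ?thesis using 3 u by (simp add: q flip: \<alpha>_def \<beta>_def)
      qed
    qed
    then show ?thesis by (simp add: mem)
  qed
  show ?thesis
    unfolding cantor_map_image_unit_cube[OF N] face_of_def
    using ends by (intro conjI ballI impI convex_Int convex_box(1) Int_lower1) (blast+)
qed

text \<open>Two opposite corners suffice: the lower one yields \<open>t' $ k \<le> t $ k\<close>,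
  the upper one the reverse inequality.\<close>

lemma grid_cube_subset_imp_eq:
  fixes t t' :: "real ^ 'd"
  assumes N: "N > 0" and "cantor_map N t ` unit_cube \<subseteq> cantor_map N t' ` unit_cube"
  shows "t = t'"
proof -
  have "cantor_map N t 0 \<in> cbox (cantor_map N t 0) (cantor_map N t 1)"
       "cantor_map N t 1 \<in> cbox (cantor_map N t 0) (cantor_map N t 1)"
    using N by (auto simp: mem_box_cart divide_right_mono)
  then have "cantor_map N t 0 \<in> cbox (cantor_map N t' 0) (cantor_map N t' 1)"
            "cantor_map N t 1 \<in> cbox (cantor_map N t' 0) (cantor_map N t' 1)"
    using assms(2) unfolding cantor_map_image_unit_cube[OF N] by blast+
  then have "t $ k = t' $ k" for k
    using N by (auto simp: mem_box_cart field_simps intro!: antisym)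
  then show ?thesis by (simp add: vec_eq_iff)
qed

text \<open>Distinct grid cubes are not nested, so the intersection is a proper face and loses
  dimension. Non-emptiness excludes the value -1 of \<open>aff_dim\<close>.\<close>

lemma common_proper_face_grid_cubes:
  fixes t t' :: "real ^ 'd"
  assumes N: "N > 0" and int: "\<And>k. t $ k \<in> \<int>" "\<And>k. t' $ k \<in> \<int>" and "t \<noteq> t'"
    and ne: "cantor_map N t ` unit_cube \<inter> cantor_map N t' ` unit_cube \<noteq> {}"
  shows "common_proper_face (cantor_map N t ` unit_cube) (cantor_map N t' ` unit_cube)"
proof -
  let ?A = "cantor_map N t ` unit_cube" and ?B = "cantor_map N t' ` unit_cube"
  have A: "?A \<inter> ?B face_of ?A"
    using grid_cubes_Int_face_of[OF N int] .
  have B: "?A \<inter> ?B face_of ?B"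
    using grid_cubes_Int_face_of[OF N int(2,1)] by (simp add: Int_commute)
  have "?A \<inter> ?B \<noteq> ?A"
    using grid_cube_subset_imp_eq[OF N, of t t'] \<open>t \<noteq> t'\<close> by blast
  moreover have "convex ?A"
    by (simp add: cantor_map_image_unit_cube[OF N])
  ultimately have "aff_dim (?A \<inter> ?B) < aff_dim ?A"
    using A by (intro face_of_aff_dim_lt)
  also have "aff_dim ?A \<le> int CARD('d)"
    using aff_dim_le_DIM[of ?A] by simp
  finally have "aff_dim (?A \<inter> ?B) \<le> int CARD('d) - 1"
    by simp
  moreover have "0 \<le> aff_dim (?A \<inter> ?B)"
    using ne aff_dim_negative_iff[of "?A \<inter> ?B"] by linarith
  ultimately show ?thesis
    using A B unfolding common_proper_face_def by blast
qed

section \<open>The attractor: one-step expansion and inclusion in the unit cube\<close>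

locale cantor_gd_attractor =
  fixes G :: "('v, 'e) pre_digraph"
    and N :: nat
    and t :: "'e \<Rightarrow> real ^ 'd"
    and \<phi> :: "'e \<Rightarrow> real ^ 'd \<Rightarrow> real ^ 'd"
    and K :: "'v \<Rightarrow> (real ^ 'd) set"
  assumes N2: "N \<ge> 2"
    and fin_verts: "finite (verts G)"
    and digits: "\<And>e k. e \<in> arcs G \<Longrightarrow> t e $ k \<in> real ` {0..N - 1}"
    and \<phi>_eq: "\<And>e. e \<in> arcs G \<Longrightarrow> \<phi> e = cantor_map N (t e)"
    and attractor: "gd_attractor G \<phi> K"
begin

lemma N_pos: "N > 0"
  using N2 by simp

lemma attractor_nonempty: "i \<in> verts G \<Longrightarrow> K i \<noteq> {}"
  and attractor_compact: "i \<in> verts G \<Longrightarrow> compact (K i)"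
  and attractor_eq: "i \<in> verts G \<Longrightarrow> K i = (\<Union>j \<in> verts G. \<Union>e \<in> arcs_between G i j. \<phi> e ` K j)"
  using attractor by (auto simp only: gd_attractor_def)

lemma attractor_cases:
  assumes "i \<in> verts G" "x \<in> K i"
  obtains j e y where "j \<in> verts G" "e \<in> arcs_between G i j" "y \<in> K j" "x = \<phi> e y"
  using assms attractor_eq[of i] by blast

lemma attractor_intro:
  assumes "i \<in> verts G" "j \<in> verts G" "e \<in> arcs_between G i j" "y \<in> K j"
  shows "\<phi> e y \<in> K i"
  using assms attractor_eq[of i] by blast

lemma arcs_between_cantor_map: "e \<in> arcs_between G i j \<Longrightarrow> \<phi> e = cantor_map N (t e)"
  by (simp add: arcs_between_def \<phi>_eq)

lemma digit_bounds:
  assumes "e \<in> arcs G" shows "0 \<le> t e $ k" "t e $ k \<le> real N - 1"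
  \<comment> \<open>In \<open>digits\<close> the term \<open>N - 1\<close> is a subtraction of
    naturals; \<open>N2\<close> lets it become \<open>real N - 1\<close>.\<close>
  using digits[OF assms, of k] N2 by (auto simp: of_nat_diff)

lemma digit_Ints: "e \<in> arcs_between G i j \<Longrightarrow> t e $ k \<in> \<int>"
  using digits[of e k] by (auto simp: arcs_between_def)

text \<open>
  A coordinate attains its maximum \<open>M\<close> and its minimum \<open>m\<close> on the compact union of all the
  \<open>K i\<close>; the self-similarity gives \<open>M \<le> (M + N - 1) / N\<close> and \<open>m \<ge> m / N\<close>.
\<close>

lemma attractor_subset_unit_cube:
  assumes i: "i \<in> verts G" shows "K i \<subseteq> unit_cube"
proof -
  define U where "U = (\<Union>i \<in> verts G. K i)"
  have U: "compact U" "U \<noteq> {}"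
    using fin_verts attractor_compact attractor_nonempty i by (auto simp: U_def intro!: compact_UN)
  have step: "\<exists>e\<in>arcs G. \<exists>y\<in>U. x = cantor_map N (t e) y" if x: "x \<in> U" for x
  proof -
    obtain v where v: "v \<in> verts G" "x \<in> K v"
      using x by (auto simp: U_def)
    then obtain j e y where "j \<in> verts G" "e \<in> arcs_between G v j" "y \<in> K j" "x = \<phi> e y"
      by (rule attractor_cases)
    then show ?thesis
      using \<phi>_eq by (auto simp: U_def arcs_between_def)
  qed
  have bounds: "0 \<le> x $ k \<and> x $ k \<le> 1" if "x \<in> U" for x k
  proof -
    have cont: "continuous_on U (\<lambda>x. x $ k)"
      by (intro continuous_intros)
    obtain a where a: "a \<in> U" "\<And>y. y \<in> U \<Longrightarrow> y $ k \<le> a $ k"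
      using continuous_attains_sup[OF U cont] by blast
    obtain b where b: "b \<in> U" "\<And>y. y \<in> U \<Longrightarrow> b $ k \<le> y $ k"
      using continuous_attains_inf[OF U cont] by blast
    obtain e y where e: "e \<in> arcs G" "y \<in> U" "a = cantor_map N (t e) y"
      using step[OF a(1)] by blast
    have "real N * a $ k = y $ k + t e $ k"
      using e(3) N_pos by simp
    then have "(real N - 1) * a $ k \<le> real N - 1"
      using a(2)[OF e(2)] digit_bounds(2)[OF e(1), of k] by (simp add: algebra_simps)
    then have a1: "a $ k \<le> 1"
      using N2 by (simp add: mult_le_cancel_left1)
    obtain e' z where e': "e' \<in> arcs G" "z \<in> U" "b = cantor_map N (t e') z"
      using step[OF b(1)] by blast
    have "real N * b $ k = z $ k + t e' $ k"
      using e'(3) N_pos by simp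
    then have "0 \<le> (real N - 1) * b $ k"
      using b(2)[OF e'(2)] digit_bounds(1)[OF e'(1), of k] by (simp add: algebra_simps)
    then have "0 \<le> b $ k"
      using N2 by (simp add: zero_le_mult_iff)
    with a1 show ?thesis
      using a(2)[OF that] b(2)[OF that] by linarith
  qed
  have "K i \<subseteq> U"
    using i by (auto simp: U_def)
  also have "U \<subseteq> unit_cube"
    using bounds by (simp add: subset_iff unit_cube_def mem_box_cart)
  finally show ?thesis .
qed

section \<open>Edges and walks of the intersection graph\<close>

abbreviation "H \<equiv> intersection_graph G \<phi>"

lemma verts_H: "verts H = verts G \<times> verts G"
  and tail_H: "tail H (c, u, v) = u"
  and head_H: "head H (c, u, v) = v"
  by (simp_all add: intersection_graph_def)

lemma mem_arcs_H: "(c, (i, j), (i', j')) \<in> arcs H \<longleftrightarrow>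
    i \<in> verts G \<and> j \<in> verts G \<and> i' \<in> verts G \<and> j' \<in> verts G \<and> i \<noteq> j \<and>
    int_edge_rel G \<phi> (c, (i, j), (i', j'))"
  by (simp add: intersection_graph_def)

lemma arcs_H_cases:
  assumes "a \<in> arcs H"
  obtains c i j i' j' where "a = (c, (i, j), (i', j'))"
  using assms by (cases a) auto

lemma terminated_finite_walk_single:
  assumes "(c, (i, j), (i', j')) \<in> arcs H" "terminated G \<phi> K (c, (i, j), (i', j'))"
  shows "terminated_finite_walk G \<phi> K (i, j) [(c, (i, j), (i', j'))]"
  using assms
  by (auto simp: terminated_finite_walk_def pre_digraph.awalk_def pre_digraph.cas.simps
      tail_H head_H verts_H mem_arcs_H)

lemma terminated_finite_walk_Cons:
  assumes "a \<in> arcs H" "solid a" "terminated_finite_walk G \<phi> K (head H a) p"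
  shows "terminated_finite_walk G \<phi> K (tail H a) (a # p)"
proof -
  obtain c i j i' j' where a: "a = (c, (i, j), (i', j'))"
    using assms(1) by (rule arcs_H_cases)
  then have "tail H a \<in> verts H"
    using assms(1) by (simp add: tail_H verts_H mem_arcs_H)
  then show ?thesis
    using assms
    by (auto simp: terminated_finite_walk_def pre_digraph.awalk_def pre_digraph.cas.simps)
qed

section \<open>From walks to common points\<close>

text \<open>For a solid edge, \<open>terminated\<close> records only that the target is diagonal;
  the shared map comes from membership in \<open>arcs H\<close>, and it sends any point of
  \<open>K i'\<close> into both attractors. For a dashed edge, the termination condition itself
  supplies the common point.\<close>

lemma terminated_imp_Int_nonempty:
  assumes "(c, (i, j), (i', j')) \<in> arcs H" "terminated G \<phi> K (c, (i, j), (i', j'))"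
  shows "K i \<inter> K j \<noteq> {}"
proof (cases c)
  case Solid
  with assms obtain e e' where ee: "i' \<in> verts G" "i \<in> verts G" "j \<in> verts G" "i' = j'"
      "e \<in> arcs_between G i i'" "e' \<in> arcs_between G j j'" "\<phi> e = \<phi> e'"
    by (auto simp: mem_arcs_H)
  moreover obtain y where "y \<in> K i'"
    using attractor_nonempty ee by blast
  ultimately have "\<phi> e y \<in> K i" "\<phi> e y \<in> K j"
    using attractor_intro by (metis)+
  then show ?thesis by blast
next
  case Dashed
  with assms obtain e e' where V: "i \<in> verts G" "j \<in> verts G" "i' \<in> verts G" "j' \<in> verts G"
      and e: "e \<in> arcs_between G i i'" "e' \<in> arcs_between G j j'"
      and "\<phi> e ` K i' \<inter> \<phi> e' ` K j' \<noteq> {}"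
    by (auto simp: mem_arcs_H)
  moreover have "\<phi> e ` K i' \<subseteq> K i" "\<phi> e' ` K j' \<subseteq> K j"
    using attractor_intro V e by blast+
  ultimately show ?thesis by blast
qed

lemma solid_arc_Int_nonempty:
  assumes "(Solid, (i, j), (i', j')) \<in> arcs H" "K i' \<inter> K j' \<noteq> {}"
  shows "K i \<inter> K j \<noteq> {}"
proof -
  obtain e e' y where "e \<in> arcs_between G i i'" "e' \<in> arcs_between G j j'" "\<phi> e = \<phi> e'"
      "y \<in> K i'" "y \<in> K j'"
    using assms by (auto simp: mem_arcs_H)
  then have "\<phi> e y \<in> K i \<inter> K j"
    using attractor_intro assms(1) by (metis IntI mem_arcs_H)
  then show ?thesis by blast
qed

lemma terminated_finite_walk_imp_Int_nonempty:
  "terminated_finite_walk G \<phi> K (i, j) p \<Longrightarrow> K i \<inter> K j \<noteq> {}"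
proof (induction p arbitrary: i j)
  case Nil
  then show ?case by (simp add: terminated_finite_walk_def)
next
  case (Cons a p)
  obtain v1 v2 where v: "a \<in> arcs H" "set p \<subseteq> arcs H" "tail H a = (i, j)"
      "pre_digraph.cas H (head H a) p (v1, v2)"
    using Cons.prems
    by (auto simp: terminated_finite_walk_def pre_digraph.awalk_def pre_digraph.cas.simps)
  obtain c i' j' where a: "a = (c, (i, j), (i', j'))"
    using v(1,3) by (auto elim!: arcs_H_cases simp: tail_H)
  show ?case
  \<comment> \<open>If \<open>p = []\<close>, then \<open>a\<close> is itself the terminated edge.
    Otherwise \<open>a\<close> lies in the \<open>butlast\<close> of the walk and is therefore
    solid.\<close>
  proof (cases "p = []")
    case True
    then show ?thesis
      using Cons.prems v(1) terminated_imp_Int_nonempty by (simp add: terminated_finite_walk_def a)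
  next
    case False
    then have c: "c = Solid"
      using Cons.prems by (simp add: terminated_finite_walk_def solid_def a)
    \<comment> \<open>Dropping \<open>a\<close> keeps the end vertex, and as \<open>p\<close> is
      non-empty its last edge is still the terminated one.\<close>
    have "terminated_finite_walk G \<phi> K (i', j') p"
      unfolding terminated_finite_walk_def pre_digraph.awalk_def
      using Cons.prems False v by (auto simp: terminated_finite_walk_def a head_H verts_H mem_arcs_H
          intro!: exI[of _ "(v1, v2)"] simp del: split_paired_Ex)
    then show ?thesis
      using Cons.IH solid_arc_Int_nonempty v(1) a c by blast
  qed
qed

text \<open>By compactness the distance of the target attractors is realised by two points; the
  shared map carries them into \<open>K i\<close> and \<open>K j\<close> and divides their distance
  by \<open>N\<close>.\<close>

lemma solid_arc_setdist:
  assumes "(Solid, (i, j), (i', j')) \<in> arcs H"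
  shows "setdist (K i) (K j) \<le> setdist (K i') (K j') / real N"
proof -
  obtain e e' where e: "e \<in> arcs_between G i i'" "e' \<in> arcs_between G j j'" "\<phi> e = \<phi> e'"
      and V: "i \<in> verts G" "j \<in> verts G" "i' \<in> verts G" "j' \<in> verts G"
    using assms by (auto simp: mem_arcs_H)
  obtain x y where xy: "x \<in> K i'" "y \<in> K j'" "setdist (K i') (K j') = dist x y"
    using setdist_compact_closed[of "K i'" "K j'"] attractor_compact attractor_nonempty V
    by (metis compact_imp_closed)
  have "\<phi> e x \<in> K i" "\<phi> e y \<in> K j"
    using attractor_intro e V xy by metis+
  then have "setdist (K i) (K j) \<le> dist (\<phi> e x) (\<phi> e y)"
    by (rule setdist_le_dist)
  then show ?thesis
    by (simp add: arcs_between_cantor_map[OF e(1)] dist_cantor_map xy(3))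
qed

text \<open>Iterating \<open>solid_arc_setdist\<close> bounds the initial distance by a uniform
  constant over \<open>N ^ k\<close> for every \<open>k\<close>. Hence it is 0, which for non-empty
  compact sets means a common point.\<close>

lemma infinite_solid_walk_imp_Int_nonempty:
  assumes w: "infinite_solid_walk G \<phi> (i, j) w" and V: "i \<in> verts G" "j \<in> verts G"
  shows "K i \<inter> K j \<noteq> {}"
proof -
  \<comment> \<open>\<open>D k\<close> is the distance between the two attractors at the pair from
    which the k-th edge starts.\<close>
  define D where "D = (\<lambda>k. setdist (K (fst (tail H (w k)))) (K (snd (tail H (w k)))))"
  have arc: "w k \<in> arcs H" "solid (w k)" "head H (w k) = tail H (w (Suc k))" for k
    using w by (auto simp: infinite_solid_walk_def infinite_walk_def)
  have D_Suc: "D k \<le> D (Suc k) / real N" for k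
  proof -
    obtain i j i' j' where wk: "w k = (Solid, (i, j), (i', j'))"
      using arc(1,2)[of k] by (auto simp: solid_def elim!: arcs_H_cases)
    then have "tail H (w (Suc k)) = (i', j')"
      using arc(3)[of k] by (simp add: head_H)
    then show ?thesis
      using solid_arc_setdist arc(1)[of k] by (simp add: D_def wk tail_H)
  qed
  have D_0: "D 0 \<le> D k / real N ^ k" for k
  proof (induction k)
    case (Suc k)
    have "D k / real N ^ k \<le> D (Suc k) / real N / real N ^ k"
      using D_Suc by (intro divide_right_mono) auto
    with Suc show ?case by simp
  qed simp
  \<comment> \<open>All attractors lie in the unit cube, so a bound on its diameter bounds every
    \<open>D k\<close> independently of \<open>k\<close>.\<close>
  obtain C where C: "\<And>x y. x \<in> unit_cube \<Longrightarrow> y \<in> unit_cube \<Longrightarrow> dist (x :: real ^ 'd) y \<le> C"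
    using bounded_cbox[of 0 "1 :: real ^ 'd"]
    by (auto simp: bounded_two_points unit_cube_def)
  have D_le: "D k \<le> C" for k
  proof -
    obtain c i j i' j' where wk: "w k = (c, (i, j), (i', j'))"
      using arcs_H_cases[OF arc(1)] .
    have ij: "tail H (w k) = (i, j)" "i \<in> verts G" "j \<in> verts G"
      using arc(1)[of k] by (auto simp: wk tail_H mem_arcs_H)
    then obtain x y where "x \<in> K i" "y \<in> K j"
      using attractor_nonempty by blast
    then show ?thesis
      using setdist_le_dist[of x "K i" y "K j"] C[of x y] attractor_subset_unit_cube ij
      by (fastforce simp: D_def)
  qed
  have "D 0 \<le> C * (1 / real N) ^ k" for k
    using order_trans[OF D_0[of k] divide_right_mono[OF D_le]] by (simp add: power_divide)
  moreover have "(\<lambda>k. C * (1 / real N) ^ k) \<longlonglongrightarrow> C * 0"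
    using N2 by (intro tendsto_intros LIMSEQ_realpow_zero) auto
  ultimately have "D 0 \<le> 0"
    by (intro LIMSEQ_le_const[of _ "C * 0", simplified]) auto
  moreover have "D 0 = setdist (K i) (K j)"
    using w by (simp add: D_def infinite_solid_walk_def infinite_walk_def)
  ultimately have "setdist (K i) (K j) = 0"
    using setdist_pos_le[of "K i" "K j"] by simp
  then show ?thesis
    using attractor_nonempty V attractor_compact
    by (simp add: setdist_eq_0_compact_closed compact_imp_closed)
qed

section \<open>From common points to walks\<close>

text \<open>A common point is expanded by one level on each side. Equal digits give a solid edge,
  and injectivity makes the two preimages one point; distinct digits give a dashed edge, terminated
  by the point itself. The second alternative demands \<open>i' \<noteq> j'\<close> because edges
  leave only off-diagonal pairs.\<close>

lemma Int_nonempty_cases: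
  assumes V: "i \<in> verts G" "j \<in> verts G" "i \<noteq> j" and ne: "K i \<inter> K j \<noteq> {}"
  obtains
    (terminated) c i' j' where "(c, (i, j), (i', j')) \<in> arcs H"
      "terminated G \<phi> K (c, (i, j), (i', j'))"
  | (solid) i' j' where "(Solid, (i, j), (i', j')) \<in> arcs H" "i' \<noteq> j'" "K i' \<inter> K j' \<noteq> {}"
proof -
  obtain x where x: "x \<in> K i" "x \<in> K j"
    using ne by blast
  obtain i' e y where e: "i' \<in> verts G" "e \<in> arcs_between G i i'" "y \<in> K i'" "x = \<phi> e y"
    using attractor_cases V(1) x(1) by blast
  obtain j' e' z where e': "j' \<in> verts G" "e' \<in> arcs_between G j j'" "z \<in> K j'" "x = \<phi> e' z"
    using attractor_cases V(2) x(2) by blast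
  note \<phi> = arcs_between_cantor_map[OF e(2)] arcs_between_cantor_map[OF e'(2)]
  show thesis
  proof (cases "t e = t e'")
    case True
    then have arc: "(Solid, (i, j), (i', j')) \<in> arcs H"
      using V e(1,2) e'(1,2) \<phi> unfolding mem_arcs_H int_edge_rel.simps by metis
    have "y = z"
      using inj_cantor_map[OF N_pos] e(4) e'(4) True \<phi> by (metis injD)
    then have "K i' \<inter> K j' \<noteq> {}"
      using e e' by blast
    then show thesis
      using terminated[OF arc] solid[OF arc] by (cases "i' = j'") auto
  next
    case False
    \<comment> \<open>The inclusion of the attractors in the unit cube turns the common point into
      an intersection of grid cubes.\<close>
    have "x \<in> \<phi> e ` unit_cube \<inter> \<phi> e' ` unit_cube"
      using e e' attractor_subset_unit_cube by blast
    then have face: "common_proper_face (\<phi> e ` unit_cube) (\<phi> e' ` unit_cube)"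
      using False digit_Ints e(2) e'(2) N_pos unfolding \<phi>
      by (intro common_proper_face_grid_cubes) auto
    then have "(Dashed, (i, j), (i', j')) \<in> arcs H"
      using V e e' by (auto simp: mem_arcs_H)
    moreover have "\<phi> e ` K i' \<inter> \<phi> e' ` K j' \<noteq> {}"
      using e e' by blast
    then have "terminated G \<phi> K (Dashed, (i, j), (i', j'))"
      using face e(2) e'(2) by auto
    ultimately show thesis
      by (rule terminated)
  qed
qed

text \<open>Without a terminated walk, only the solid alternative of
  \<open>Int_nonempty_cases\<close> can occur. A terminated walk from the new pair could be
  prolonged by the solid edge in front, so its absence is inherited and the construction never
  stops.\<close>

lemma Int_nonempty_imp_walk:
  assumes V: "i \<in> verts G" "j \<in> verts G" "i \<noteq> j" and ne: "K i \<inter> K j \<noteq> {}"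
    and no_walk: "\<nexists>p. terminated_finite_walk G \<phi> K (i, j) p"
  obtains w where "infinite_solid_walk G \<phi> (i, j) w"
proof -
  \<comment> \<open>\<open>P\<close> is the invariant of the vertices visited; besides the common
    point it carries the absence of a terminated walk.\<close>
  define P where "P = (\<lambda>(i, j). i \<in> verts G \<and> j \<in> verts G \<and> i \<noteq> j \<and> K i \<inter> K j \<noteq> {} \<and>
    (\<nexists>p. terminated_finite_walk G \<phi> K (i, j) p))"
  have step: "\<exists>a. a \<in> arcs H \<and> solid a \<and> tail H a = u \<and> P (head H a)" if u: "P u" for u
  proof -
    obtain i j where ij: "u = (i, j)" by (cases u)
    have Pij: "i \<in> verts G" "j \<in> verts G" "i \<noteq> j" "K i \<inter> K j \<noteq> {}"
      and no: "\<And>p. \<not> terminated_finite_walk G \<phi> K (i, j) p"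
      using u by (auto simp: P_def ij)
    from Pij show ?thesis
    proof (cases rule: Int_nonempty_cases)
      case (terminated c i' j')
      then show ?thesis using terminated_finite_walk_single no by blast
    next
      case (solid i' j')
      let ?a = "(Solid, (i, j), (i', j'))"
      have a: "Defs.solid ?a"
        by (simp add: solid_def)
      have "\<not> terminated_finite_walk G \<phi> K (i', j') p" for p
        using terminated_finite_walk_Cons[OF solid(1) a, of p] no[of "?a # p"]
        by (auto simp: head_H tail_H)
      then have "P (i', j')"
        using solid by (auto simp: P_def mem_arcs_H)
      then show ?thesis
        using solid(1) a by (intro exI[of _ ?a]) (auto simp: head_H tail_H ij)
    qed
  qed
  have P0: "P (i, j)"
    using V ne no_walk by (simp add: P_def)
  \<comment> \<open>The dependent choice runs over edges, as an infinite walk is a sequence of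
    edges; the clause for \<open>k = 0\<close> fixes its starting vertex.\<close>
  have "\<exists>w. \<forall>k. (w k \<in> arcs H \<and> solid (w k) \<and> P (head H (w k)) \<and> (k = 0 \<longrightarrow> tail H (w k) = (i, j))) \<and>
      head H (w k) = tail H (w (Suc k))"
    using step[OF P0] step
    by (intro dependent_nat_choice[where
          P = "\<lambda>k a. a \<in> arcs H \<and> solid a \<and> P (head H a) \<and> (k = 0 \<longrightarrow> tail H a = (i, j))"
          and Q = "\<lambda>k a b. head H a = tail H b"]) (blast, fastforce)
  then obtain w where "\<And>k. w k \<in> arcs H \<and> solid (w k) \<and> (k = 0 \<longrightarrow> tail H (w k) = (i, j))"
      "\<And>k. head H (w k) = tail H (w (Suc k))"
    by blast
  then have "infinite_solid_walk G \<phi> (i, j) w"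
    by (simp add: infinite_solid_walk_def infinite_walk_def)
  then show thesis by (rule that)
qed

end

theorem theorem1p5:
  fixes n N :: nat
    and G :: "(nat, 'e) pre_digraph"
    and t :: "'e \<Rightarrow> real ^ 'd"
    and \<phi> :: "'e \<Rightarrow> real ^ 'd \<Rightarrow> real ^ 'd"
    and K :: "nat \<Rightarrow> (real ^ 'd) set"
  assumes "n \<ge> 1" and "N \<ge> 2"
    and "fin_digraph G" and "verts G = {1..n}"
    and "\<And>i. i \<in> verts G \<Longrightarrow> out_arcs G i \<noteq> {}"
    and "\<And>e k. e \<in> arcs G \<Longrightarrow> t e $ k \<in> real ` {0..N - 1}"
    and "\<And>e. e \<in> arcs G \<Longrightarrow> \<phi> e = cantor_map N (t e)"
    and "\<And>i j e e'. e \<in> arcs_between G i j \<Longrightarrow> e' \<in> arcs_between G i j \<Longrightarrow> e \<noteq> e' \<Longrightarrow> \<phi> e \<noteq> \<phi> e'"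
    and "gd_attractor G \<phi> K"
  shows "\<forall>i \<in> {1..n}. \<forall>j \<in> {1..n}. i \<noteq> j \<longrightarrow>
    (K i \<inter> K j \<noteq> {} \<longleftrightarrow>
      (\<exists>p. terminated_finite_walk G \<phi> K (i, j) p) \<or>
      (\<exists>w. infinite_solid_walk G \<phi> (i, j) w))"
proof -
  interpret fin_digraph G by fact
  interpret cantor_gd_attractor G N t \<phi> K
    using assms(2,6,7,9) finite_verts by unfold_locales auto
  show ?thesis
    using terminated_finite_walk_imp_Int_nonempty infinite_solid_walk_imp_Int_nonempty
      Int_nonempty_imp_walk \<open>verts G = {1..n}\<close>
    by metis
qed

end
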